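(* Let $\mathcal{X}=\overline{([-x_1,x_2],0)}$ with $x_1,x_2>0$ and $x_1<x_2$. Then for any $\mathcal{Y}=\overline{([-y_1,y_2],0)}$ with $y_1,y_2>0$ and $\dfrac{x_1}{x_2}<\dfrac{y_2}{y_1}$, $\dfrac{x_1}{x_2}<\dfrac{y_1}{y_2}$, there is $\mathcal{Z}=\overline{([-z_1,z_2],0)}$ (with $[-z_1,z_2]\in\mathbb{IR}$) such that $\mathcal{Y}=\mathcal{X}\bullet\mathcal{Z}$.
   Context: $\mathbb{IR}$ is the set of intervals $[a,b]$ with real $a\le b$, with addition $[a,b]+[c,d]=[a+c,b+d]$; $0$ also denotes $[0,0]$. $\overline{\mathbb{IR}}$ is the quotient of $\mathbb{IR}\times\mathbb{IR}$ by $(x,y)\sim(z,t)\iff x+t=y+z$, the class of $(x,y)$ being $\overline{(x,y)}$, with $\overline{(x,y)}+\overline{(z,t)}=\overline{(x+z,y+t)}$; every element can be written $\overline{(K,0)}$ or $\overline{(0,K)}$ with $K\in\mathbb{IR}$. $\mathcal{A}_4$ is the algebra $\mathbb{R}^4$ with product $x\cdot y=(x_1y_1+x_4y_4,\;x_2y_2+x_3y_3,\;x_3y_2+x_2y_3,\;x_4y_1+x_1y_4)$. For $K=[a,b]\in\mathbb{IR}$, $\varphi(K)=(a,b,0,0)$ if $a,b\ge0$; $(0,b,-a,0)$ if $a\le 0\le b$; $(0,0,-a,-b)$ if $a,b\le 0$. Define $\overline{\varphi}:\overline{\mathbb{IR}}\to\mathcal{A}_4$ by $\overline{\varphi}(\overline{(K,0)})=\varphi(K)$,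 $\overline{\varphi}(\overline{(0,K)})=-\varphi(K)$. Let $\mathcal{R}$ be the equivalence relation on $\mathcal{A}_4$: $(x_1,x_2,x_3,x_4)\sim(y_1,y_2,y_3,y_4)\iff x_1-y_1=x_3-y_3$ and $x_2-y_2=x_4-y_4$; the composite of $\overline{\varphi}$ with the projection $\mathcal{A}_4\to\mathcal{A}_4/\mathcal{R}$ is a bijection, whose inverse is denoted $\psi:\mathcal{A}_4/\mathcal{R}\to\overline{\mathbb{IR}}$. Explicitly, with $u=x_1-x_3$, $v=x_2-x_4$, $\psi$ sends the class of $(x_1,x_2,x_3,x_4)$ to $\overline{([u,v],0)}$ if $u\le v$ and to $\overline{(0,[-u,-v])}$ if $u\ge v$. The product on $\overline{\mathbb{IR}}$ is $\mathcal{X}\bullet\mathcal{X}'=\psi$ of the class of $\overline{\varphi}(\mathcal{X})\cdot\overline{\varphi}(\mathcal{X}')$. *)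

theory Defs
  imports "HOL-Analysis.Analysis" "HOL-Library.Interval"
begin

section \<open>Generalized intervals\<close>

text \<open>
  A compact interval \<open>[a, b]\<close> with \<open>a \<le> b\<close> is \<open>Interval (a, b)\<close>. As \<open>Interval\<close> is a typedef
  abstraction function, this term is meaningful only together with \<open>a \<le> b\<close>.
\<close>

lemma lower_Interval [simp]: "lower (Interval (a, b)) = a" if "a \<le> b" for a b :: real
  using that by (simp add: lower.rep_eq Interval_inverse)

lemma upper_Interval [simp]: "upper (Interval (a, b)) = b" if "a \<le> b" for a b :: real
  using that by (simp add: upper.rep_eq Interval_inverse)

fun gint_rel :: "real interval \<times> real interval \<Rightarrow> real interval \<times> real interval \<Rightarrow> bool" where
  "gint_rel (x, y) (z, t) \<longleftrightarrow> x + t = y + z"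

quotient_type gint = "real interval \<times> real interval" / gint_rel
proof (rule equivpI)
  show "reflp gint_rel"
    by (auto simp: reflp_def add.commute)
  show "symp gint_rel"
    by (auto simp: symp_def add.commute)
  show "transp gint_rel"
    by (auto simp: transp_def interval_eq_iff)
qed

lift_definition gint_class :: "real interval \<Rightarrow> real interval \<Rightarrow> gint" is Pair .

lemma gint_class_eq_iff: "gint_class x y = gint_class z t \<longleftrightarrow> x + t = y + z"
  by transfer simp

lemma gint_cases:
  obtains (pos) K where "X = gint_class K 0" | (neg) K where "X = gint_class 0 K"
proof -
  obtain x y where X: "X = gint_class x y"
  proof (transfer fixing: thesis)
    fix X :: "real interval \<times> real interval"
    assume *: "\<And>x y. gint_rel X (x, y) \<Longrightarrow> thesis"
    have "gint_rel X (fst X, snd X)"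
      by (cases X) (simp add: add.commute)
    then show thesis by (rule *)
  qed
  define u v where "u = lower x - lower y" and "v = upper x - upper y"
  show thesis
  proof (cases "u \<le> v")
    case True
    then have "X = gint_class (Interval (u, v)) 0"
      unfolding X gint_class_eq_iff by (simp add: interval_eq_iff) (simp add: u_def v_def)
    then show thesis by (rule pos)
  next
    case False
    then have "X = gint_class 0 (Interval (- u, - v))"
      unfolding X gint_class_eq_iff by (simp add: interval_eq_iff) (simp add: u_def v_def)
    then show thesis by (rule neg)
  qed
qed


section \<open>The four-dimensional algebra\<close>

text \<open>The instance \<open>*\<close> on \<open>real ^ 4\<close> is the componentwise product, hence a separate operation.\<close>

definition a4_mult :: "real ^ 4 \<Rightarrow> real ^ 4 \<Rightarrow> real ^ 4" (infixl \<open>\<cdot>\<^sub>4\<close> 70) where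
  "x \<cdot>\<^sub>4 y = vector
     [x $ 1 * y $ 1 + x $ 4 * y $ 4,
      x $ 2 * y $ 2 + x $ 3 * y $ 3,
      x $ 3 * y $ 2 + x $ 2 * y $ 3,
      x $ 4 * y $ 1 + x $ 1 * y $ 4]"

definition a4_rel :: "real ^ 4 \<Rightarrow> real ^ 4 \<Rightarrow> bool" where
  "a4_rel x y \<longleftrightarrow> x $ 1 - y $ 1 = x $ 3 - y $ 3 \<and> x $ 2 - y $ 2 = x $ 4 - y $ 4"

quotient_type a4_quot = "real ^ 4" / a4_rel
  by (rule equivpI) (auto simp: reflp_def symp_def transp_def a4_rel_def)

lift_definition a4_class :: "real ^ 4 \<Rightarrow> a4_quot" is "\<lambda>x. x" .

lemma a4_class_eq_iff:
  "a4_class x = a4_class y \<longleftrightarrow> x $ 1 - x $ 3 = y $ 1 - y $ 3 \<and> x $ 2 - x $ 4 = y $ 2 - y $ 4"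
  by transfer (auto simp: a4_rel_def)


section \<open>Embedding and product\<close>

text \<open>The three cases overlap only at zero end points, where the values agree.\<close>

definition phi :: "real interval \<Rightarrow> real ^ 4" where
  "phi K = (let a = lower K; b = upper K in
     if 0 \<le> a \<and> 0 \<le> b then vector [a, b, 0, 0]
     else if a \<le> 0 \<and> 0 \<le> b then vector [0, b, - a, 0]
     else vector [0, 0, - a, - b])"

text \<open>
  An element of the form \<open>gint_class K 0\<close> is also of the form \<open>gint_class 0 L\<close> exactly if \<open>K\<close> is a
  single point. The clauses \<open>phi K\<close> and \<open>- phi L\<close> then give different vectors (with the same image
  in \<open>a4_quot\<close>) unless \<open>K = 0\<close>; the first clause is given priority.
\<close>

definition phi_bar :: "gint \<Rightarrow> real ^ 4" where
  "phi_bar X =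
     (if \<exists>K. X = gint_class K 0 then phi (THE K. X = gint_class K 0)
      else - phi (THE K. X = gint_class 0 K))"

lemma phi_bar_pos: "phi_bar (gint_class K 0) = phi K"
proof -
  have "(THE L. gint_class K 0 = gint_class L 0) = K"
    by (rule the_equality) (auto simp: gint_class_eq_iff)
  then show ?thesis
    unfolding phi_bar_def by auto
qed

lemma phi_bar_neg:
  assumes "lower K \<noteq> upper K"
  shows "phi_bar (gint_class 0 K) = - phi K"
proof -
  have *: "(THE L. gint_class 0 K = gint_class 0 L) = K"
    by (rule the_equality) (auto simp: gint_class_eq_iff)
  have "gint_class 0 K \<noteq> gint_class L 0" for L
  proof
    assume "gint_class 0 K = gint_class L 0"
    then have "lower K + lower L = 0" "upper K + upper L = 0"
      by (simp_all add: gint_class_eq_iff interval_eq_iff)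
    then show False
      using assms lower_le_upper[of K] lower_le_upper[of L] by linarith
  qed
  then show ?thesis
    unfolding phi_bar_def by (simp add: *)
qed

lemma vector_4_real:
  fixes a b c d :: real
  shows "(vector [a, b, c, d] :: real ^ 4) $ 1 = a" "(vector [a, b, c, d] :: real ^ 4) $ 2 = b"
    "(vector [a, b, c, d] :: real ^ 4) $ 3 = c" "(vector [a, b, c, d] :: real ^ 4) $ 4 = d"
  by (simp_all add: vector_def)

lemma phi_diff:
  "phi K $ 1 - phi K $ 3 = lower K" "phi K $ 2 - phi K $ 4 = upper K"
  using lower_le_upper[of K] by (auto simp: phi_def Let_def vector_4_real)

lemma a4_class_phi_bar_neg: "a4_class (phi_bar (gint_class 0 K)) = a4_class (- phi K)"
proof (cases "lower K = upper K")
  case True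
  then have "gint_class 0 K = gint_class (- K) 0"
    by (simp add: gint_class_eq_iff interval_eq_iff)
  moreover have "a4_class (phi (- K)) = a4_class (- phi K)"
    using True phi_diff[of K] phi_diff[of "- K"] by (simp add: a4_class_eq_iff)
  ultimately show ?thesis
    by (simp add: phi_bar_pos)
qed (simp add: phi_bar_neg)

lemma bij_a4_class_phi_bar: "bij (a4_class \<circ> phi_bar)"
proof (rule bijI)
  have neg: "a4_class (- phi K) = a4_class y \<longleftrightarrow> y $ 1 - y $ 3 = - lower K \<and> y $ 2 - y $ 4 = - upper K"
    for K y
    using phi_diff[of K] by (auto simp: a4_class_eq_iff)
  have pos: "a4_class (phi K) = a4_class y \<longleftrightarrow> y $ 1 - y $ 3 = lower K \<and> y $ 2 - y $ 4 = upper K"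
    for K y
    using phi_diff[of K] by (auto simp: a4_class_eq_iff)
  have phi_neg: "(- phi K) $ 1 - (- phi K) $ 3 = - lower K" "(- phi K) $ 2 - (- phi K) $ 4 = - upper K"
    for K
    using phi_diff[of K] by simp_all
  show "inj (a4_class \<circ> phi_bar)"
  proof (rule injI)
    fix X Y assume eq: "(a4_class \<circ> phi_bar) X = (a4_class \<circ> phi_bar) Y"
    show "X = Y"
      using eq
      by (cases X rule: gint_cases; cases Y rule: gint_cases)
        (simp_all only: o_apply phi_bar_pos a4_class_phi_bar_neg pos neg phi_neg phi_diff
          gint_class_eq_iff interval_eq_iff lower_plus upper_plus lower_zero upper_zero, auto)
  qed
  show "surj (a4_class \<circ> phi_bar)"
  proof (rule surjI)
    define g where "g y = (let u = y $ 1 - y $ 3; v = y $ 2 - y $ 4 in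
      if u \<le> v then gint_class (Interval (u, v)) 0
      else gint_class 0 (Interval (- u, - v)))" for y :: "real ^ 4"
    show "(a4_class \<circ> phi_bar) (g (rep_a4_quot q)) = q" for q
    proof -
      have "a4_class (rep_a4_quot q) = q"
        by (simp add: a4_class.abs_eq Quotient3_abs_rep[OF Quotient3_a4_quot]
            a4_class_def map_fun_def)
      moreover have "a4_class (phi_bar (g y)) = a4_class y" for y
        by (auto simp: g_def Let_def phi_bar_pos a4_class_phi_bar_neg pos neg)
      ultimately show ?thesis by simp
    qed
  qed
qed

definition psi :: "a4_quot \<Rightarrow> gint" where
  "psi = inv (a4_class \<circ> phi_bar)"

lemma psi_a4_class:
  assumes "u = x $ 1 - x $ 3" and "v = x $ 2 - x $ 4"
  shows "u \<le> v \<Longrightarrow> psi (a4_class x) = gint_class (Interval (u, v)) 0"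
    and "v \<le> u \<Longrightarrow> psi (a4_class x) = gint_class 0 (Interval (- u, - v))"
proof -
  have *: "psi (a4_class x) = X" if "a4_class (phi_bar X) = a4_class x" for X
    unfolding psi_def using that bij_a4_class_phi_bar by (auto intro!: inv_f_eq simp: bij_def)
  show "psi (a4_class x) = gint_class (Interval (u, v)) 0" if "u \<le> v"
    using that assms by (intro *) (simp add: phi_bar_pos a4_class_eq_iff phi_diff)
  show "psi (a4_class x) = gint_class 0 (Interval (- u, - v))" if "v \<le> u"
  proof (rule *)
    have "phi (Interval (- u, - v)) $ 1 - phi (Interval (- u, - v)) $ 3 = - u"
      "phi (Interval (- u, - v)) $ 2 - phi (Interval (- u, - v)) $ 4 = - v"
      using that by (simp_all add: phi_diff)
    then show "a4_class (phi_bar (gint_class 0 (Interval (- u, - v)))) = a4_class x"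
      using assms by (simp add: a4_class_phi_bar_neg a4_class_eq_iff)
  qed
qed

definition gint_mult :: "gint \<Rightarrow> gint \<Rightarrow> gint" (infixl \<open>\<bullet>\<^sub>g\<close> 70) where
  "X \<bullet>\<^sub>g Y = psi (a4_class (phi_bar X \<cdot>\<^sub>4 phi_bar Y))"

end

theory Submission
  imports Defs
begin

text \<open>For intervals around zero, \<open>phi\<close> lands in the plane of coordinates 2 and 3,
  where the product is that of split-complex numbers \<open>b + a j\<close> with
  \<open>j^2 = 1\<close>. Dividing by \<open>X\<close> is thus a symmetric 2x2 linear system with
  determinant \<open>x2^2 - x1^2 > 0\<close>. Its solution is positive, so \<open>Z\<close> is again
  an interval around zero and \<open>gint_mult_zero_between\<close> applies.\<close>

lemma phi_Interval_zero_between: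
  assumes "0 < a" "0 \<le> b"
  shows "phi (Interval (- a, b)) = vector [0, b, a, 0]"
  using assms by (simp add: phi_def)

lemma gint_mult_zero_between:
  fixes a b c d :: real
  assumes "0 < a" "0 \<le> b" "0 < c" "0 \<le> d"
  shows "gint_class (Interval (- a, b)) 0 \<bullet>\<^sub>g gint_class (Interval (- c, d)) 0 =
    gint_class (Interval (- (a * d + b * c), b * d + a * c)) 0"
proof -
  have nonneg: "0 \<le> a * d" "0 \<le> b * c" "0 \<le> b * d" "0 \<le> a * c"
    using assms by simp_all
  show ?thesis
    unfolding gint_mult_def phi_bar_pos
      phi_Interval_zero_between[OF assms(1,2)] phi_Interval_zero_between[OF assms(3,4)]
    \<comment> \<open>The signs give \<open>u \<le> 0 \<le> v\<close>, the proper-interval case of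
      \<open>psi\<close>.\<close>
    using nonneg by (intro psi_a4_class(1)) (simp_all add: a4_mult_def vector_4_real)
qed

theorem proposition22:
  fixes x1 x2 y1 y2 :: real and X Y :: gint
  assumes "X = gint_class (Interval (- x1, x2)) 0"
    and "0 < x1" and "0 < x2" and "x1 < x2"
    and "Y = gint_class (Interval (- y1, y2)) 0"
    and "0 < y1" and "0 < y2"
    and "x1 / x2 < y2 / y1" and "x1 / x2 < y1 / y2"
  shows "\<exists>z1 z2 Z. - z1 \<le> z2 \<and> Z = gint_class (Interval (- z1, z2)) 0 \<and> Y = X \<bullet>\<^sub>g Z"
proof -
  \<comment> \<open>Cramer's rule for \<open>x2 * z1 + x1 * z2 = y1\<close> and \<open>x1 * z1 + x2 * z2 = y2\<close>;
    the two ratio hypotheses say that the numerators are positive.\<close>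
  define D where "D = x2 * x2 - x1 * x1"
  define z1 where "z1 = (x2 * y1 - x1 * y2) / D"
  define z2 where "z2 = (x2 * y2 - x1 * y1) / D"
  have D: "0 < D"
    using assms(2,4) by (simp add: D_def mult_strict_mono)
  have "x1 * y1 < x2 * y2" "x1 * y2 < x2 * y1"
    using assms by (simp_all add: field_simps)
  then have pos: "0 < z1" "0 < z2"
    using D by (simp_all add: z1_def z2_def)
  have "x1 * z2 + x2 * z1 = y1" "x2 * z2 + x1 * z1 = y2"
    \<comment> \<open>\<open>D\<close> stays opaque until the denominators are cleared; its
      expansion then leaves a polynomial identity.\<close>
    using D by (simp_all add: z1_def z2_def add_divide_distrib[symmetric] divide_eq_eq)
      (simp_all add: D_def algebra_simps)
  then have "Y = X \<bullet>\<^sub>g gint_class (Interval (- z1, z2)) 0"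
    using assms(1-3,5) pos by (simp add: gint_mult_zero_between)
  moreover have "- z1 \<le> z2"
    using pos by simp
  ultimately show ?thesis
    by blast
qed

end
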